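(* Let $T=(V,E)$ be a finite tree and $e\in V$. If for every $x,y\in V$ with $d(e,x)>d(e,y)$ we have $b_e(x)\leq b_e(y)$, then $T$ is a generated monoid graph.
   Context: All monoids and graphs are finite. $d$ denotes the graph distance in $T$. For a vertex $x$, the number of successors of $x$ with respect to $e$ is $b_e(x)=|\{y\in V\mid \{x,y\}\in E,\ d(e,y)=d(e,x)+1\}|$. For a monoid $M$ and $C\subseteq M$, $\underline{\mathrm{Cay}}(M,C)$ is the simple undirected graph with vertex set $M$ in which distinct $x,y$ are adjacent if and only if $y=xc$ or $x=yc$ for some $c\in C$. A generated monoid graph is a graph isomorphic to $\underline{\mathrm{Cay}}(M,C)$ for some monoid $M$ and some $C\subseteq M$ with $M=\langle C\rangle$ (i.e. $C$ generates $M$ as a monoid). *)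

theory Defs
  imports "HOL-Algebra.Group" "HOL.Hull"
begin

section \<open>Finite simple graphs\<close>

text \<open>
  A graph is given by its vertex set \<open>V\<close> and its edge set \<open>E\<close>, a set of two-element subsets
  of \<open>V\<close>. The notion of tree in the AFP entry on directed graphs is not usable here: in a
  symmetric digraph every edge already gives a directed cycle of length two.
\<close>

definition fin_simple_graph :: "'a set \<Rightarrow> 'a set set \<Rightarrow> bool" where
  "fin_simple_graph V E \<longleftrightarrow>
     finite V \<and> (\<forall>d\<in>E. \<exists>x\<in>V. \<exists>y\<in>V. x \<noteq> y \<and> d = {x, y})"

text \<open>Walks are nonempty vertex lists; a walk \<open>p\<close> has \<open>length p - 1\<close> edges.\<close>

definition walk :: "'a set \<Rightarrow> 'a set set \<Rightarrow> 'a \<Rightarrow> 'a list \<Rightarrow> 'a \<Rightarrow> bool" where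
  "walk V E u p v \<longleftrightarrow>
     p \<noteq> [] \<and> set p \<subseteq> V \<and> hd p = u \<and> last p = v \<and>
     successively (\<lambda>x y. {x, y} \<in> E) p"

definition connected_graph :: "'a set \<Rightarrow> 'a set set \<Rightarrow> bool" where
  "connected_graph V E \<longleftrightarrow> V \<noteq> {} \<and> (\<forall>u\<in>V. \<forall>v\<in>V. \<exists>p. walk V E u p v)"

text \<open>A cycle is listed without repeating its first vertex at the end.\<close>

definition graph_cycle :: "'a set \<Rightarrow> 'a set set \<Rightarrow> 'a list \<Rightarrow> bool" where
  "graph_cycle V E p \<longleftrightarrow>
     3 \<le> length p \<and> distinct p \<and> walk V E (hd p) p (last p) \<and> {last p, hd p} \<in> E"

definition fin_tree :: "'a set \<Rightarrow> 'a set set \<Rightarrow> bool" where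
  "fin_tree V E \<longleftrightarrow>
     fin_simple_graph V E \<and> connected_graph V E \<and> (\<nexists>p. graph_cycle V E p)"

text \<open>Only meaningful for vertices that are joined by a walk.\<close>

definition graph_dist :: "'a set \<Rightarrow> 'a set set \<Rightarrow> 'a \<Rightarrow> 'a \<Rightarrow> nat" where
  "graph_dist V E u v = (LEAST n. \<exists>p. walk V E u p v \<and> length p = Suc n)"

definition num_successors :: "'a set \<Rightarrow> 'a set set \<Rightarrow> 'a \<Rightarrow> 'a \<Rightarrow> nat" where
  "num_successors V E e x =
     card {y \<in> V. {x, y} \<in> E \<and> graph_dist V E e y = graph_dist V E e x + 1}"

definition graph_isomorphic ::
    "'a set \<Rightarrow> 'a set set \<Rightarrow> 'b set \<Rightarrow> 'b set set \<Rightarrow> bool" where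
  "graph_isomorphic V E W F \<longleftrightarrow>
     (\<exists>f. bij_betw f V W \<and> (\<forall>x\<in>V. \<forall>y\<in>V. {x, y} \<in> E \<longleftrightarrow> {f x, f y} \<in> F))"


section \<open>Generated monoid graphs\<close>

definition monoid_generated :: "('m, 'r) monoid_scheme \<Rightarrow> 'm set \<Rightarrow> 'm set" where
  "monoid_generated M C = (\<lambda>H. submonoid H M) hull C"

definition cay_edges :: "('m, 'r) monoid_scheme \<Rightarrow> 'm set \<Rightarrow> 'm set set" where
  "cay_edges M C =
     {{x, y} | x y. x \<in> carrier M \<and> y \<in> carrier M \<and> x \<noteq> y \<and>
        (\<exists>c\<in>C. y = x \<otimes>\<^bsub>M\<^esub> c \<or> x = y \<otimes>\<^bsub>M\<^esub> c)}"

text \<open>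
  A definition cannot quantify over the type of the monoid elements. As all monoids are finite,
  carriers of type \<open>nat\<close> lose no generality; see the lemma \<open>generated_monoid_graphI\<close> below.
\<close>

definition generated_monoid_graph :: "'a set \<Rightarrow> 'a set set \<Rightarrow> bool" where
  "generated_monoid_graph V E \<longleftrightarrow>
     fin_simple_graph V E \<and>
     (\<exists>(M :: nat monoid) C.
        monoid M \<and> finite (carrier M) \<and> C \<subseteq> carrier M \<and>
        monoid_generated M C = carrier M \<and>
        graph_isomorphic V E (carrier M) (cay_edges M C))"

lemma cay_edges_iff:
  assumes "x \<in> carrier M" "y \<in> carrier M"
  shows "{x, y} \<in> cay_edges M C \<longleftrightarrow>
    x \<noteq> y \<and> (\<exists>c\<in>C. y = x \<otimes>\<^bsub>M\<^esub> c \<or> x = y \<otimes>\<^bsub>M\<^esub> c)"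
  using assms unfolding cay_edges_def by (auto simp: doubleton_eq_iff)

lemma monoid_generated_eq_carrier_iff:
  assumes "monoid M" "C \<subseteq> carrier M"
  shows "monoid_generated M C = carrier M \<longleftrightarrow>
    (\<forall>H. submonoid H M \<longrightarrow> C \<subseteq> H \<longrightarrow> H = carrier M)"
proof -
  have "submonoid (carrier M) M"
    using assms(1) by (simp add: submonoid_def monoid.m_closed monoid.one_closed)
  then show ?thesis
    using assms(2) submonoid.subset[of _ M] unfolding monoid_generated_def hull_def
    by blast
qed

lemma generated_monoid_graphI:
  fixes M :: "('m, 'r) monoid_scheme"
  assumes G: "fin_simple_graph V E"
    and M: "monoid M" and fin: "finite (carrier M)" and C: "C \<subseteq> carrier M"
    and gen: "monoid_generated M C = carrier M"
    and iso: "graph_isomorphic V E (carrier M) (cay_edges M C)"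
  shows "generated_monoid_graph V E"
proof -
  interpret M: monoid M by (fact M)
  obtain g where g: "bij_betw g (carrier M) {0..<card (carrier M)}"
    using ex_bij_betw_finite_nat[OF fin] by blast
  define h where "h = inv_into (carrier M) g"
  define N :: "nat monoid" where
    "N = \<lparr>carrier = {0..<card (carrier M)}, mult = (\<lambda>x y. g (h x \<otimes>\<^bsub>M\<^esub> h y)), one = g \<one>\<^bsub>M\<^esub>\<rparr>"
  have bij: "bij_betw g (carrier M) (carrier N)" using g by (simp add: N_def)
  have cN: "carrier N = g ` carrier M" using bij by (simp add: bij_betw_def)
  have inj: "inj_on g (carrier M)" using bij by (simp add: bij_betw_def)
  have hg: "h (g x) = x" if "x \<in> carrier M" for x
    using that inj by (simp add: h_def)
  have mN: "g x \<otimes>\<^bsub>N\<^esub> g y = g (x \<otimes>\<^bsub>M\<^esub> y)" if "x \<in> carrier M" "y \<in> carrier M" for x y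
    using that by (simp add: N_def hg)
  have oN: "\<one>\<^bsub>N\<^esub> = g \<one>\<^bsub>M\<^esub>" by (simp add: N_def)
  have N: "monoid N"
    by (rule monoidI) (auto simp: cN mN oN M.m_assoc)
  have CN: "g ` C \<subseteq> carrier N" using C cN by auto
  have "H = carrier N" if H: "submonoid H N" "g ` C \<subseteq> H" for H
  proof -
    define K where "K = {x \<in> carrier M. g x \<in> H}"
    have "submonoid K M"
      using H(1) unfolding submonoid_def K_def by (auto simp: oN mN[symmetric])
    moreover have "C \<subseteq> K" using H(2) C by (auto simp: K_def)
    ultimately have "K = carrier M"
      using gen monoid_generated_eq_carrier_iff[OF M C] by blast
    then show ?thesis using submonoid.subset[OF H(1)] cN by (auto simp: K_def)
  qed
  then have genN: "monoid_generated N (g ` C) = carrier N"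
    using monoid_generated_eq_carrier_iff[OF N CN] by blast
  obtain f where f: "bij_betw f V (carrier M)"
    "\<And>x y. x \<in> V \<Longrightarrow> y \<in> V \<Longrightarrow> {x, y} \<in> E \<longleftrightarrow> {f x, f y} \<in> cay_edges M C"
    using iso unfolding graph_isomorphic_def by blast
  have edge: "{g x, g y} \<in> cay_edges N (g ` C) \<longleftrightarrow> {x, y} \<in> cay_edges M C"
    if xy: "x \<in> carrier M" "y \<in> carrier M" for x y
  proof -
    have "g u = g v \<otimes>\<^bsub>N\<^esub> g c \<longleftrightarrow> u = v \<otimes>\<^bsub>M\<^esub> c"
      if "u \<in> carrier M" "v \<in> carrier M" "c \<in> C" for u v c
      using that C mN[of v c] inj_on_eq_iff[OF inj, of u "v \<otimes>\<^bsub>M\<^esub> c"] by auto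
    moreover have "g x = g y \<longleftrightarrow> x = y" using inj_on_eq_iff[OF inj] xy by blast
    moreover have "g x \<in> carrier N" "g y \<in> carrier N" using xy cN by auto
    ultimately show ?thesis using xy by (simp add: cay_edges_iff)
  qed
  have "graph_isomorphic V E (carrier N) (cay_edges N (g ` C))"
    unfolding graph_isomorphic_def
  proof (intro exI conjI ballI)
    show "bij_betw (g \<circ> f) V (carrier N)" by (rule bij_betw_trans[OF f(1) bij])
    fix x y assume xy: "x \<in> V" "y \<in> V"
    then have "f x \<in> carrier M" "f y \<in> carrier M" using bij_betwE[OF f(1)] by auto
    then show "{x, y} \<in> E \<longleftrightarrow> {(g \<circ> f) x, (g \<circ> f) y} \<in> cay_edges N (g ` C)"
      using f(2)[OF xy] edge by simp
  qed
  moreover have "finite (carrier N)" by (simp add: N_def)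
  ultimately show ?thesis
    using G N CN genN unfolding generated_monoid_graph_def by blast
qed

end

theory Submission
  imports Defs
begin

text \<open>
  Number the successors of every vertex \<open>x\<close> as \<open>x\<^sub>0, \<dots>, x\<^sub>k\<close> and let the generator with index \<open>i\<close>
  send \<open>x\<close> to the successor of index \<open>min i k\<close>, or fix \<open>x\<close> if \<open>x\<close> is a leaf. The maps
  \<open>r\<^sub>i\<close> obtained in this way act on \<open>V\<close>, and they are the right multiplications of a monoid on \<open>V\<close>
  with identity \<open>e\<close> as soon as for every \<open>x\<close> some map \<open>l\<^sub>x\<close> with \<open>l\<^sub>x e = x\<close> commutes with all of them.
  Following the path from \<open>e\<close> to \<open>y\<close> by the same indices starting in \<open>x\<close> defines \<open>l\<^sub>x y\<close>. If
  \<open>x \<noteq> e\<close>, this vertex is either deeper than \<open>y\<close> or a leaf, hence has at most as many successors as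
  \<open>y\<close>, so that the index truncation at \<open>y\<close> is absorbed by the one at \<open>l\<^sub>x y\<close>.
\<close>

section \<open>The monoid of an indexed rooted tree\<close>

text \<open>Walks are abstracted away: \<open>child x\<close> enumerates the successors of
  \<open>x\<close> by the indices below \<open>b x\<close>, while \<open>parent\<close> and
  \<open>idx\<close> invert this enumeration. In the application \<open>d\<close> is the distance
  from \<open>e\<close>.\<close>

locale indexed_tree =
  fixes V :: "'a set" and e :: 'a and d :: "'a \<Rightarrow> nat" and b :: "'a \<Rightarrow> nat"
    and child :: "'a \<Rightarrow> nat \<Rightarrow> 'a" and parent :: "'a \<Rightarrow> 'a" and idx :: "'a \<Rightarrow> nat"
  assumes root_in: "e \<in> V"
    and depth_root: "d e = 0"
    and child_in: "\<lbrakk>x \<in> V; i < b x\<rbrakk> \<Longrightarrow> child x i \<in> V"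
    and depth_child: "\<lbrakk>x \<in> V; i < b x\<rbrakk> \<Longrightarrow> d (child x i) = Suc (d x)"
    and parent_child: "\<lbrakk>x \<in> V; i < b x\<rbrakk> \<Longrightarrow> parent (child x i) = x"
    and idx_child: "\<lbrakk>x \<in> V; i < b x\<rbrakk> \<Longrightarrow> idx (child x i) = i"
    and parent_in: "\<lbrakk>y \<in> V; y \<noteq> e\<rbrakk> \<Longrightarrow> parent y \<in> V"
    and idx_less: "\<lbrakk>y \<in> V; y \<noteq> e\<rbrakk> \<Longrightarrow> idx y < b (parent y)"
    and child_parent: "\<lbrakk>y \<in> V; y \<noteq> e\<rbrakk> \<Longrightarrow> child (parent y) (idx y) = y"
    and branching_antimono: "\<lbrakk>x \<in> V; y \<in> V; d y < d x\<rbrakk> \<Longrightarrow> b x \<le> b y"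
begin

lemma depth_pos: "\<lbrakk>y \<in> V; y \<noteq> e\<rbrakk> \<Longrightarrow> 0 < d y"
  using depth_child[OF parent_in idx_less, of y] child_parent[of y] by simp

lemma tree_induct [consumes 1, case_names root child]:
  assumes "y \<in> V" and "P e" and "\<And>x i. \<lbrakk>x \<in> V; i < b x; P x\<rbrakk> \<Longrightarrow> P (child x i)"
  shows "P y"
  using assms(1)
proof (induction "d y" arbitrary: y rule: less_induct)
  case less
  show ?case
  proof (cases "y = e")
    case False
    with less.prems have p: "parent y \<in> V" "idx y < b (parent y)" "child (parent y) (idx y) = y"
      by (simp_all add: parent_in idx_less child_parent)
    then have "P (parent y)"
      using depth_child[OF p(1,2)] less.hyps by simp
    with assms(3)[OF p(1,2)] p(3) show ?thesis by simp
  qed (simp add: assms(2))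
qed

text \<open>Every other vertex is strictly deeper than the root. Hence the indices below
  \<open>b e\<close> suffice at every vertex.\<close>

lemma branching_le_root: "x \<in> V \<Longrightarrow> b x \<le> b e"
  using branching_antimono[OF _ root_in] depth_pos depth_root by (cases "x = e") auto

section \<open>Right action of the generators and left translations\<close>

definition step :: "nat \<Rightarrow> 'a \<Rightarrow> 'a" where
  "step i x = (if b x = 0 then x else child x (min i (b x - 1)))"

lemma step_in: "x \<in> V \<Longrightarrow> step i x \<in> V"
  by (simp add: step_def child_in)

lemma step_child: "i < b x \<Longrightarrow> step i x = child x i"
  by (simp add: step_def min.absorb1)

text \<open>Both indices are truncated to the last one at \<open>z\<close>; if \<open>z\<close> is a
  leaf, both maps fix it.\<close>

lemma step_beyond: "b x \<le> i \<Longrightarrow> b z \<le> b x \<Longrightarrow> step (b x - 1) z = step i z"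
  by (simp add: step_def min.absorb2)

text \<open>The number stands for the depth of \<open>y\<close> and makes the recursion along
  \<open>parent\<close> primitive. The indices are read from \<open>y\<close> upwards but applied
  from the root downwards, starting in \<open>x\<close>.\<close>

primrec left_translate :: "'a \<Rightarrow> nat \<Rightarrow> 'a \<Rightarrow> 'a" where
  "left_translate x 0 y = x"
| "left_translate x (Suc n) y = step (idx y) (left_translate x n (parent y))"

definition tmult :: "'a \<Rightarrow> 'a \<Rightarrow> 'a" where
  "tmult x y = left_translate x (d y) y"

lemma tmult_root: "tmult x e = x"
  by (simp add: tmult_def depth_root)

lemma tmult_child: "\<lbrakk>y \<in> V; i < b y\<rbrakk> \<Longrightarrow> tmult x (child y i) = step i (tmult x y)"
  by (simp add: tmult_def depth_child parent_child idx_child)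

lemma tmult_in: "\<lbrakk>y \<in> V; x \<in> V\<rbrakk> \<Longrightarrow> tmult x y \<in> V"
  by (induction rule: tree_induct)
    (simp_all add: tmult_root tmult_child step_in)

lemma root_tmult: "y \<in> V \<Longrightarrow> tmult e y = y"
  by (induction rule: tree_induct) (simp_all add: tmult_root tmult_child step_child)

text \<open>Since \<open>x\<close> is not the root, it starts with a lead in depth. Each step keeps
  this lead until a leaf is reached, and leaves are fixed from then on.\<close>

lemma tmult_leaf_or_deeper:
  assumes "x \<in> V" "x \<noteq> e" "y \<in> V"
  shows "b (tmult x y) = 0 \<or> d y < d (tmult x y)"
  using assms(3)
proof (induction rule: tree_induct)
  case root
  then show ?case using assms by (simp add: tmult_root depth_root depth_pos)
next
  case (child y i)
  then show ?case
    using depth_child[OF tmult_in[OF child(1) assms(1)]]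
    by (cases "b (tmult x y) = 0") (simp_all add: tmult_child depth_child step_def)
qed

lemma branching_tmult: "\<lbrakk>x \<in> V; y \<in> V\<rbrakk> \<Longrightarrow> b (tmult x y) \<le> b y"
  using tmult_leaf_or_deeper[of x y] branching_antimono[of "tmult x y" y] tmult_in[of y x]
  by (cases "x = e") (auto simp: root_tmult)

text \<open>This is where associativity comes from. The critical case is an index truncated at
  \<open>y\<close>: by \<open>branching_tmult\<close> the translated vertex has no more successors
  than \<open>y\<close>, so it truncates at least as much.\<close>

lemma tmult_step:
  assumes "x \<in> V" "y \<in> V"
  shows "tmult x (step i y) = step i (tmult x y)"
proof (cases "i < b y")
  case True
  then show ?thesis using assms by (simp add: step_child tmult_child)
next
  case False
  note le = branching_tmult[OF assms]
  show ?thesis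
  proof (cases "b y = 0")
    case True
    \<comment> \<open>The translate of a leaf is a leaf by \<open>le\<close>, so
      \<open>step i\<close> fixes both vertices.\<close>
    then show ?thesis using le by (simp add: step_def)
  next
    case nz: False
    then have "step i y = child y (b y - 1)" using False by (simp add: step_def min.absorb2)
    then have "tmult x (step i y) = step (b y - 1) (tmult x y)"
      using nz assms by (simp add: tmult_child)
    also have "\<dots> = step i (tmult x y)" using step_beyond[OF _ le] False by simp
    finally show ?thesis .
  qed
qed

text \<open>Passing from \<open>z\<close> to \<open>child z i\<close> applies \<open>step i\<close>
  to both sides, on the right-hand side by \<open>tmult_step\<close>.\<close>

lemma tmult_assoc:
  assumes "x \<in> V" "y \<in> V" "z \<in> V"
  shows "tmult (tmult x y) z = tmult x (tmult y z)"
  using assms(3) by (induction rule: tree_induct)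
    (simp_all add: tmult_root tmult_child tmult_step tmult_in assms)

section \<open>The monoid and its Cayley graph\<close>

definition tree_monoid :: "'a monoid" where
  "tree_monoid = \<lparr>carrier = V, mult = tmult, one = e\<rparr>"

lemma monoid_tree_monoid: "monoid tree_monoid"
  by (rule monoidI)
    (simp_all add: tree_monoid_def root_in tmult_in tmult_root root_tmult tmult_assoc)

lemma tmult_generator: "\<lbrakk>x \<in> V; i < b e\<rbrakk> \<Longrightarrow> tmult x (child e i) = step i x"
  by (simp add: tmult_child root_in tmult_root)

text \<open>One right multiplication by \<open>child e i\<close> leads from \<open>x\<close> to
  \<open>child x i\<close>; this generator exists because \<open>b x\<close> is at most
  \<open>b e\<close>.\<close>

lemma tree_monoid_generated:
  "monoid_generated tree_monoid (child e ` {..<b e}) = carrier tree_monoid"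
proof -
  have sub: "child e ` {..<b e} \<subseteq> carrier tree_monoid"
    by (auto simp: tree_monoid_def root_in child_in)
  have "H = carrier tree_monoid"
    if H: "submonoid H tree_monoid" "child e ` {..<b e} \<subseteq> H" for H
  proof
    show "H \<subseteq> carrier tree_monoid" using H(1) by (rule submonoid.subset)
    show "carrier tree_monoid \<subseteq> H"
    proof
      fix y assume "y \<in> carrier tree_monoid"
      then have "y \<in> V" by (simp add: tree_monoid_def)
      then show "y \<in> H"
      proof (induction rule: tree_induct)
        case root
        show ?case using submonoid.one_closed[OF H(1)] by (simp add: tree_monoid_def)
      next
        case (child x i)
        then have i: "i < b e" using branching_le_root[of x] by simp
        then have "tmult x (child e i) \<in> H"
          using submonoid.m_closed[OF H(1) child(3), of "child e i"] H(2)
          by (auto simp: tree_monoid_def)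
        then show ?case using i child by (simp add: tmult_generator step_child)
      qed
    qed
  qed
  then show ?thesis
    using monoid_generated_eq_carrier_iff[OF monoid_tree_monoid sub] by blast
qed

text \<open>A generator either fixes a leaf, which \<open>x \<noteq> y\<close> excludes, or moves to
  a successor. Each successor is reached by the generator of its own index.\<close>

lemma step_generator_iff:
  assumes "x \<in> V" "x \<noteq> y"
  shows "(\<exists>c \<in> child e ` {..<b e}. y = tmult x c) \<longleftrightarrow> (\<exists>i<b x. y = child x i)"
proof -
  have "(\<exists>c \<in> child e ` {..<b e}. y = tmult x c) \<longleftrightarrow> (\<exists>i<b e. y = step i x)"
    using assms(1) by (auto simp: tmult_generator)
  also have "\<dots> \<longleftrightarrow> (\<exists>i<b x. y = child x i)"
  proof
    assume "\<exists>i<b e. y = step i x"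
    then obtain i where i: "y = step i x" by blast
    then have "b x \<noteq> 0" using assms(2) step_def by metis
    then have "min i (b x - 1) < b x" "y = child x (min i (b x - 1))"
      using i by (simp_all add: step_def)
    then show "\<exists>i<b x. y = child x i" by blast
  next
    assume "\<exists>i<b x. y = child x i"
    then show "\<exists>i<b e. y = step i x"
      using branching_le_root[OF assms(1)] by (metis order_less_le_trans step_child)
  qed
  finally show ?thesis .
qed

text \<open>The vertices are the monoid elements, so the identity is the isomorphism. Neither graph
  has loops, and for distinct vertices \<open>step_generator_iff\<close> applies in both
  directions.\<close>

lemma generated_monoid_graph_indexed_tree:
  assumes G: "fin_simple_graph V E"
    and edge: "\<And>x y. \<lbrakk>x \<in> V; y \<in> V\<rbrakk> \<Longrightarrow>
      {x, y} \<in> E \<longleftrightarrow> (\<exists>i<b x. y = child x i) \<or> (\<exists>i<b y. x = child y i)"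
  shows "generated_monoid_graph V E"
proof (rule generated_monoid_graphI[OF G monoid_tree_monoid _ _ tree_monoid_generated])
  show "finite (carrier tree_monoid)"
    using G by (simp add: tree_monoid_def fin_simple_graph_def)
  show "child e ` {..<b e} \<subseteq> carrier tree_monoid"
    by (auto simp: tree_monoid_def root_in child_in)
  have "{x, y} \<in> E \<longleftrightarrow> {x, y} \<in> cay_edges tree_monoid (child e ` {..<b e})"
    if xy: "x \<in> V" "y \<in> V" for x y
  proof (cases "x = y")
    case True
    then have "{x, y} \<notin> E" using G by (auto simp: fin_simple_graph_def)
    then show ?thesis
      using True xy cay_edges_iff[of x tree_monoid y] by (simp add: tree_monoid_def)
  next
    case False
    then show ?thesis
      using xy step_generator_iff[of x y] step_generator_iff[of y x]
      by (simp add: edge cay_edges_iff tree_monoid_def bex_disj_distrib)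
  qed
  then show "graph_isomorphic V E (carrier tree_monoid)
      (cay_edges tree_monoid (child e ` {..<b e}))"
    unfolding graph_isomorphic_def
    by (intro exI[of _ id]) (simp add: tree_monoid_def)
qed

end


section \<open>Distances in trees\<close>

lemma walk_snoc:
  assumes "walk V E u p v" "w \<in> V" "{v, w} \<in> E"
  shows "walk V E u (p @ [w]) w"
  using assms by (auto simp: walk_def successively_append_iff)

lemma walk_Cons:
  assumes "walk V E v p w" "u \<in> V" "{u, v} \<in> E"
  shows "walk V E u (u # p) w"
  using assms by (cases p) (auto simp: walk_def)

lemma walk_butlast:
  assumes "walk V E u p v" "length p = Suc (Suc n)"
  obtains w where "walk V E u (butlast p) w" "w \<in> V" "{w, v} \<in> E"
proof -
  define q where "q = butlast p"
  have q: "q \<noteq> []" using assms(2) by (auto simp: q_def simp flip: length_greater_0_conv)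
  have p: "p = q @ [v]" using assms by (auto simp: walk_def q_def)
  have "walk V E u q (last q)" "{last q, v} \<in> E"
    using assms(1) q unfolding p by (auto simp: walk_def successively_append_iff)
  moreover from this(1) have "last q \<in> V" using q by (auto simp: walk_def)
  ultimately show thesis using that unfolding q_def by blast
qed

section \<open>Distance from the root in a connected graph\<close>

locale rooted_graph =
  fixes V :: "'a set" and E :: "'a set set" and e :: 'a
  assumes simple: "fin_simple_graph V E" and connected: "connected_graph V E"
    and root: "e \<in> V"
begin

abbreviation depth :: "'a \<Rightarrow> nat" where
  "depth \<equiv> graph_dist V E e"

lemma shortest_walk:
  assumes "x \<in> V"
  obtains p where "walk V E e p x" "length p = Suc (depth x)"
proof -
  obtain p where p: "walk V E e p x"
    using connected root assms unfolding connected_graph_def by blast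
  then have "length p = Suc (length p - 1)" by (cases p) (auto simp: walk_def)
  then have "\<exists>n p. walk V E e p x \<and> length p = Suc n" using p by blast
  then have "\<exists>p. walk V E e p x \<and> length p = Suc (depth x)"
    unfolding graph_dist_def by (rule LeastI_ex)
  with that show thesis by blast
qed

lemma depth_le: "\<lbrakk>walk V E e p x; length p = Suc n\<rbrakk> \<Longrightarrow> depth x \<le> n"
  unfolding graph_dist_def by (rule Least_le) blast

lemma depth_root_eq_0: "depth e = 0"
  using depth_le[of "[e]" e 0] root by (simp add: walk_def)

lemma depth_eq_0_imp:
  assumes "x \<in> V" "depth x = 0"
  shows "x = e"
proof -
  obtain p where "walk V E e p x" "length p = Suc 0"
    using shortest_walk[OF assms(1)] assms(2) by auto
  then show ?thesis by (auto simp: walk_def length_Suc_conv)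
qed

lemma depth_edge_le:
  assumes "x \<in> V" "y \<in> V" "{x, y} \<in> E"
  shows "depth y \<le> Suc (depth x)"
proof -
  obtain p where p: "walk V E e p x" "length p = Suc (depth x)"
    using shortest_walk[OF assms(1)] by blast
  show ?thesis using depth_le[OF walk_snoc[OF p(1) assms(2,3)]] p(2) by simp
qed

text \<open>The last but one vertex of a shortest walk to \<open>y\<close> has depth at most
  \<open>n\<close>, and the edge to \<open>y\<close> gives the converse bound.\<close>

lemma predecessor:
  assumes "y \<in> V" "depth y = Suc n"
  obtains x where "x \<in> V" "{x, y} \<in> E" "depth x = n"
proof -
  obtain p where p: "walk V E e p y" "length p = Suc (Suc n)"
    using shortest_walk[OF assms(1)] assms(2) by metis
  obtain x where x: "walk V E e (butlast p) x" "x \<in> V" "{x, y} \<in> E"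
    using walk_butlast[OF p] by blast
  have "depth x \<le> n" using depth_le[OF x(1)] p(2) by simp
  moreover have "Suc n \<le> Suc (depth x)"
    using depth_edge_le[OF x(2) assms(1) x(3)] assms(2) by simp
  ultimately show thesis using that x by simp
qed

text \<open>Climb from both vertices level by level until the two ascents meet. The depth bound
  keeps the path simple when new endpoints are added one level below, and later lets a deeper vertex
  close it to a cycle.\<close>

lemma path_within_depth:
  assumes "u \<in> V" "v \<in> V" "u \<noteq> v" "depth u = n" "depth v = n"
  shows "\<exists>p. walk V E u p v \<and> distinct p \<and> 3 \<le> length p \<and> (\<forall>w\<in>set p. depth w \<le> n)"
  using assms
proof (induction n arbitrary: u v)
  case 0
  \<comment> \<open>Only the root has depth 0, contrary to \<open>u \<noteq> v\<close>.\<close>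
  then show ?case using depth_eq_0_imp by metis
next
  case (Suc n)
  obtain u' where u': "u' \<in> V" "{u', u} \<in> E" "depth u' = n" using predecessor Suc.prems by metis
  obtain v' where v': "v' \<in> V" "{v', v} \<in> E" "depth v' = n" using predecessor Suc.prems by metis
  have uu': "{u, u'} \<in> E" using u'(2) by (simp add: insert_commute)
  \<comment> \<open>If the ascents meet here, the path is a single vertex. No lower bound on its
    length is claimed: nonemptiness suffices, as \<open>u\<close> and \<open>v\<close> are
    added.\<close>
  have "\<exists>q. walk V E u' q v' \<and> distinct q \<and> (\<forall>w\<in>set q. depth w \<le> n)"
  proof (cases "u' = v'")
    case True
    then have "walk V E u' [u'] v'" using u' by (simp add: walk_def)
    then show ?thesis using u' by (intro exI[of _ "[u']"]) simp
  next
    case False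
    then show ?thesis using Suc.IH u' v' by blast
  qed
  then obtain q where q: "walk V E u' q v'" "distinct q" "\<forall>w\<in>set q. depth w \<le> n"
    by blast
  have "walk V E u (u # q @ [v]) v"
    using walk_Cons[OF walk_snoc[OF q(1) Suc.prems(2) v'(2)] Suc.prems(1) uu'] by simp
  moreover have "distinct (u # q @ [v])" using q Suc.prems by auto
  moreover have "q \<noteq> []" using q(1) by (simp add: walk_def)
  ultimately show ?case
    using q Suc.prems by (intro exI[of _ "u # q @ [v]"]) (auto simp: Suc_le_eq)
qed

end

section \<open>Levels and unique predecessors in a tree\<close>

locale rooted_tree = rooted_graph +
  assumes acyclic: "\<not> graph_cycle V E p"
begin

text \<open>An edge inside a level would close the path from \<open>path_within_depth\<close> to a
  cycle.\<close>

lemma depth_edge_neq: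
  assumes "x \<in> V" "y \<in> V" "{x, y} \<in> E"
  shows "depth x \<noteq> depth y"
proof
  assume eq: "depth x = depth y"
  have "x \<noteq> y" using simple assms(3) by (auto simp: fin_simple_graph_def)
  then obtain p where p: "walk V E x p y" "distinct p" "3 \<le> length p"
    using path_within_depth[OF assms(1,2)] eq by blast
  then have "graph_cycle V E p"
    using assms(3) by (auto simp: graph_cycle_def walk_def insert_commute)
  then show False using acyclic by blast
qed

lemma depth_edge:
  assumes "x \<in> V" "y \<in> V" "{x, y} \<in> E"
  shows "depth y = Suc (depth x) \<or> depth x = Suc (depth y)"
  using depth_edge_le[OF assms] depth_edge_neq[OF assms] depth_edge_le[of y x] assms
  by (force simp: insert_commute)

text \<open>Two predecessors are joined by a path no deeper than themselves. It avoids the deeper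
  vertex \<open>y\<close>, which therefore closes it to a cycle.\<close>

lemma predecessor_unique:
  assumes "x \<in> V" "x' \<in> V" "y \<in> V" "{x, y} \<in> E" "{x', y} \<in> E"
    and "depth y = Suc (depth x)" "depth y = Suc (depth x')"
  shows "x = x'"
proof (rule ccontr)
  assume "x \<noteq> x'"
  then obtain p where p: "walk V E x p x'" "distinct p" "3 \<le> length p"
      "\<forall>w\<in>set p. depth w \<le> depth x"
    using path_within_depth[OF assms(1,2)] assms(6,7) by auto
  have "walk V E y (y # p) x'"
    using walk_Cons[OF p(1) assms(3)] assms(4) by (simp add: insert_commute)
  moreover have "distinct (y # p)" using p assms(6) by auto
  ultimately have "graph_cycle V E (y # p)"
    using p(3) assms(5) by (simp add: graph_cycle_def walk_def split: if_splits)
  then show False using acyclic by blast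
qed

definition successors :: "'a \<Rightarrow> 'a set" where
  "successors x = {y \<in> V. {x, y} \<in> E \<and> depth y = depth x + 1}"

lemma edge_iff_successors:
  assumes "x \<in> V" "y \<in> V"
  shows "{x, y} \<in> E \<longleftrightarrow> y \<in> successors x \<or> x \<in> successors y"
  using depth_edge[OF assms] assms by (auto simp: successors_def insert_commute)

text \<open>The successors of each vertex may be numbered in any order. Uniqueness of predecessors
  then makes \<open>parent\<close>, and with it \<open>idx\<close>, well defined off the
  root.\<close>

lemma ex_indexed_tree:
  assumes anti: "\<And>x y. \<lbrakk>x \<in> V; y \<in> V; depth y < depth x\<rbrakk> \<Longrightarrow>
      num_successors V E e x \<le> num_successors V E e y"
  obtains child parent idx where
    "indexed_tree V e depth (num_successors V E e) child parent idx"
    "\<And>x. child x ` {..<num_successors V E e x} = successors x"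
proof -
  let ?b = "num_successors V E e"
  have "\<exists>h. bij_betw h {..<?b x} (successors x)" for x
  proof -
    have "finite (successors x)"
      using simple by (simp add: successors_def fin_simple_graph_def)
    then show ?thesis
      using ex_bij_betw_nat_finite[of "successors x"]
      by (simp add: num_successors_def successors_def atLeast0LessThan)
  qed
  then obtain child where child: "\<And>x. bij_betw (child x) {..<?b x} (successors x)"
    by metis
  \<comment> \<open>At the root the description has no witness, and its value is arbitrary.\<close>
  define parent where "parent y = (THE x. x \<in> V \<and> y \<in> successors x)" for y
  define idx where "idx y = inv_into {..<?b (parent y)} (child (parent y)) y" for y
  have parentI: "parent y = x" if "x \<in> V" "y \<in> successors x" for x y
    unfolding parent_def using that
    by (intro the_equality) (auto simp: successors_def intro: predecessor_unique)
  have child_succ: "child x i \<in> successors x" if "i < ?b x" for x i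
    using bij_betwE[OF child] that by blast
  have parent_ex: "parent y \<in> V \<and> y \<in> successors (parent y)" if y: "y \<in> V" "y \<noteq> e" for y
  proof -
    obtain n where "depth y = Suc n" using depth_eq_0_imp y by (cases "depth y") auto
    then obtain x where "x \<in> V" "y \<in> successors x"
      using predecessor[OF y(1)] y(1) by (auto simp: successors_def)
    then show ?thesis using parentI by metis
  qed
  have idx: "idx y < ?b (parent y) \<and> child (parent y) (idx y) = y"
    if y: "y \<in> V" "y \<noteq> e" for y
  proof -
    have "y \<in> child (parent y) ` {..<?b (parent y)}"
      using child[of "parent y"] parent_ex[OF y] by (simp add: bij_betw_def)
    then show ?thesis unfolding idx_def using inv_into_into f_inv_into_f by (metis lessThan_iff)
  qed
  have "indexed_tree V e depth ?b child parent idx"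
  proof
    fix x i assume x: "x \<in> V" "i < ?b x"
    note c = child_succ[OF x(2)]
    show "child x i \<in> V" "depth (child x i) = Suc (depth x)"
      using c by (simp_all add: successors_def)
    show p: "parent (child x i) = x" using parentI[OF x(1) c] .
    show "idx (child x i) = i"
      unfolding idx_def p using child[of x] x by (simp add: bij_betw_def)
  qed (use root depth_root_eq_0 parent_ex idx anti in auto)
  moreover have "child x ` {..<?b x} = successors x" for x
    using child[of x] by (simp add: bij_betw_def)
  ultimately show thesis using that by blast
qed

end

theorem theorem5p1:
  fixes V :: "'a set" and E :: "'a set set" and e :: 'a
  assumes "fin_tree V E"
    and "e \<in> V"
    and "\<And>x y. x \<in> V \<Longrightarrow> y \<in> V \<Longrightarrow> graph_dist V E e x > graph_dist V E e y \<Longrightarrow>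
           num_successors V E e x \<le> num_successors V E e y"
  shows "generated_monoid_graph V E"
proof -
  interpret rooted_tree V E e
    using assms(1,2) by unfold_locales (auto simp: fin_tree_def)
  obtain child parent idx where
    tree: "indexed_tree V e depth (num_successors V E e) child parent idx" and
    children: "\<And>x. child x ` {..<num_successors V E e x} = successors x"
    using ex_indexed_tree assms(3) by metis
  show ?thesis
  proof (rule indexed_tree.generated_monoid_graph_indexed_tree[OF tree simple])
    fix x y assume "x \<in> V" "y \<in> V"
    then show "{x, y} \<in> E \<longleftrightarrow> (\<exists>i<num_successors V E e x. y = child x i) \<or>
        (\<exists>i<num_successors V E e y. x = child y i)"
      by (auto simp: edge_iff_successors simp flip: children)
  qed
qed

end
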